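(* Let $\mathcal{S}$ and $\mathcal{A}$ be finite sets and let $p(s',d\mid s,a)$ be a transition kernel, where $s,s'\in\mathcal{S}$, $a\in\mathcal{A}$, $d\in\{0,1\}$. Let $\mu>0$ and assume that for every $(s,a,s',d)\in\mathcal{S}\times\mathcal{A}\times\mathcal{S}\times\{0,1\}$ either $p(s',d\mid s,a)=0$ or $p(s',d\mid s,a)\ge\mu$. Let $\delta\in(0,1)$. For each $(s,a)\in\mathcal{S}\times\mathcal{A}$ draw $N$ independent samples $(s',d)\sim p(\cdot\mid s,a)$ and let $$\hat p(s',d\mid s,a)=\frac{\mathrm{count}(s',d;s,a)}{N},$$ where $\mathrm{count}(s',d;s,a)$ is the number of samples drawn at $(s,a)$ that equal $(s',d)$. If $$N\ \ge\ \frac{1}{\mu}\log\frac{2|\mathcal{S}|^2|\mathcal{A}|}{\delta},$$ then with probability at least $1-\delta$ the empirical kernel $\hat p$ is a consistent kernel of $p$.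
   Context: A kernel $p(s',d\mid s,a)$ is, for each $(s,a)$, a probability distribution on $\mathcal{S}\times\{0,1\}$ (next state and binary damage indicator). A kernel $\hat p$ is a consistent kernel of $p$ if and only if $\operatorname{sign}(\hat p(s',d\mid s,a))=\operatorname{sign}(p(s',d\mid s,a))$ for all $(s,a,s',d)\in\mathcal{S}\times\mathcal{A}\times\mathcal{S}\times\{0,1\}$, i.e. $\hat p$ and $p$ have the same support. *)

theory Defs
  imports "HOL-Probability.Probability"
begin

(* "p s' d s a" stands for p(s', d | s, a); the damage indicator d is encoded as a
   Boolean, with False for 0 and True for 1. *)
type_synonym ('s, 'a) kernel = "'s \<Rightarrow> bool \<Rightarrow> 's \<Rightarrow> 'a \<Rightarrow> real"

definition transition_kernel :: "('s::finite, 'a::finite) kernel \<Rightarrow> bool" where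
  "transition_kernel p \<longleftrightarrow>
     (\<forall>s a. (\<forall>s' d. 0 \<le> p s' d s a) \<and> (\<Sum>(s', d)\<in>UNIV. p s' d s a) = 1)"

definition consistent_kernel ::
    "('s::finite, 'a::finite) kernel \<Rightarrow> ('s, 'a) kernel \<Rightarrow> bool" where
  "consistent_kernel p' p \<longleftrightarrow>
     transition_kernel p' \<and> (\<forall>s a s' d. sgn (p' s' d s a) = sgn (p s' d s a))"

(* "x s a i" is the i-th sample (next state, damage) drawn at (s, a); only the
   samples with index i < N are used. *)
definition sample_count ::
    "nat \<Rightarrow> ('s \<Rightarrow> 'a \<Rightarrow> nat \<Rightarrow> 's \<times> bool) \<Rightarrow> 's \<Rightarrow> bool \<Rightarrow> 's \<Rightarrow> 'a \<Rightarrow> nat" where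
  "sample_count N x s' d s a = card {i. i < N \<and> x s a i = (s', d)}"

definition empirical_kernel ::
    "nat \<Rightarrow> ('s \<Rightarrow> 'a \<Rightarrow> nat \<Rightarrow> 's \<times> bool) \<Rightarrow> ('s, 'a) kernel" where
  "empirical_kernel N x s' d s a = real (sample_count N x s' d s a) / real N"

(* Independence is required among the N samples drawn at the same pair (s, a);
   nothing is assumed about the joint law of samples drawn at different pairs. *)
definition sampled_from ::
    "'w measure \<Rightarrow> nat \<Rightarrow> ('s \<Rightarrow> 'a \<Rightarrow> nat \<Rightarrow> 'w \<Rightarrow> 's \<times> bool) \<Rightarrow> ('s, 'a) kernel \<Rightarrow> bool" where
  "sampled_from M N X p \<longleftrightarrow>
     (\<forall>s a. prob_space.indep_vars M (\<lambda>_. count_space UNIV) (X s a) {..<N} \<and>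
        (\<forall>i<N. \<forall>s' d. measure M {\<omega> \<in> space M. X s a i \<omega> = (s', d)} = p s' d s a))"

end

theory Submission
  imports Defs
begin

text \<open>
  The empirical kernel can only fail to be consistent if, for some \<open>(s, a, s', d)\<close>, an outcome
  of probability zero is observed (a null event), or an outcome of probability \<open>q \<ge> \<mu>\<close> is missed
  by all \<open>N\<close> samples, which happens with probability \<open>(1 - q) ^ N \<le> exp (- \<mu> N)\<close>. A union bound
  over the \<open>2 |S|\<^sup>2 |A|\<close> tuples gives the claim.
\<close>

text \<open>Each sample index falls into exactly one outcome class, so the counts add up to
  \<open>N\<close>. Positivity of \<open>N\<close> matters because division by zero yields
  0.\<close>

lemma transition_kernel_empirical_kernel:
  fixes x :: "'s::finite \<Rightarrow> 'a::finite \<Rightarrow> nat \<Rightarrow> 's \<times> bool"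
  assumes "N > 0"
  shows "transition_kernel (empirical_kernel N x)"
  unfolding transition_kernel_def
proof (intro allI conjI)
  fix s a s' d
  show "0 \<le> empirical_kernel N x s' d s a"
    by (simp add: empirical_kernel_def)
next
  fix s a
  have "(\<Sum>y\<in>UNIV. \<Sum>i\<in>{i \<in> {..<N}. x s a i = y}. 1::real) = (\<Sum>i\<in>{..<N}. 1)"
    by (rule sum.group) auto
  then show "(\<Sum>(s', d)\<in>UNIV. empirical_kernel N x s' d s a) = 1"
    using assms
    by (simp add: empirical_kernel_def sample_count_def case_prod_unfold flip: sum_divide_distrib)
qed

lemma empirical_kernel_pos_iff:
  "empirical_kernel N x s' d s a > 0 \<longleftrightarrow> (\<exists>i<N. x s a i = (s', d))"
proof -
  have "finite {i. i < N \<and> x s a i = (s', d)}" by simp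
  then show ?thesis
    by (auto simp: empirical_kernel_def sample_count_def zero_less_divide_iff card_gt_0_iff)
qed

text \<open>Both kernels are nonnegative, so their signs are 0 or 1 and agree iff the zero sets
  agree. This turns consistency into a condition on which outcomes are observed, one tuple at a
  time.\<close>

lemma consistent_empirical_kernel_iff:
  assumes "N > 0" "transition_kernel p"
  shows "consistent_kernel (empirical_kernel N x) p \<longleftrightarrow>
    (\<forall>s a s' d. p s' d s a = 0 \<longleftrightarrow> (\<forall>i<N. x s a i \<noteq> (s', d)))"
proof -
  have "sgn (empirical_kernel N x s' d s a) = sgn (p s' d s a) \<longleftrightarrow>
      (p s' d s a = 0 \<longleftrightarrow> (\<forall>i<N. x s a i \<noteq> (s', d)))" for s a s' d
  proof -
    have "p s' d s a \<ge> 0"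
      using assms(2) by (simp add: transition_kernel_def)
    moreover have "empirical_kernel N x s' d s a \<ge> 0"
      by (simp add: empirical_kernel_def)
    moreover note empirical_kernel_pos_iff[of N x s' d s a]
    ultimately show ?thesis
      by (auto simp: sgn_real_def)
  qed
  then show ?thesis
    using transition_kernel_empirical_kernel[OF assms(1), of x] by (simp add: consistent_kernel_def)
qed

lemma (in prob_space) prob_indep_vars_avoid:
  assumes ind: "indep_vars (\<lambda>_. count_space UNIV) X {..<N::nat}" and "N > 0"
    and q: "\<And>i. i < N \<Longrightarrow> prob {\<omega> \<in> space M. X i \<omega> = y} = q"
  shows "prob {\<omega> \<in> space M. \<forall>i<N. X i \<omega> \<noteq> y} = (1 - q) ^ N"
proof -
  have avoid: "prob (X i -` (- {y}) \<inter> space M) = 1 - q" if "i < N" for i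
  proof -
    have "X i \<in> measurable M (count_space UNIV)"
      using ind that by (simp add: indep_vars_def)
    then have ev: "{\<omega> \<in> space M. X i \<omega> = y} \<in> events"
      by measurable
    have "X i -` (- {y}) \<inter> space M = space M - {\<omega> \<in> space M. X i \<omega> = y}"
      by auto
    then show ?thesis
      using prob_compl[OF ev] q[OF that] by simp
  qed
  \<comment> \<open>An intersection over an empty index set would be \<open>UNIV\<close> instead of
    \<open>space M\<close>; hence the appeal to \<open>N > 0\<close>.\<close>
  have "{\<omega> \<in> space M. \<forall>i<N. X i \<omega> \<noteq> y} = (\<Inter>i\<in>{..<N}. X i -` (- {y}) \<inter> space M)"
    using \<open>N > 0\<close> by auto
  moreover have "prob (\<Inter>i\<in>{..<N}. X i -` (- {y}) \<inter> space M)
      = (\<Prod>i\<in>{..<N}. prob (X i -` (- {y}) \<inter> space M))"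
    using \<open>N > 0\<close> by (intro indep_varsD[OF ind]) auto
  ultimately show ?thesis
    using avoid by simp
qed

theorem lemma14:
  fixes p :: "('s::finite, 'a::finite) kernel"
    and \<mu> \<delta> :: real
    and N :: nat
    and M :: "'w measure"
    and X :: "'s \<Rightarrow> 'a \<Rightarrow> nat \<Rightarrow> 'w \<Rightarrow> 's \<times> bool"
  assumes "transition_kernel p"
    and "\<mu> > 0"
    and "\<forall>s a s' d. p s' d s a = 0 \<or> p s' d s a \<ge> \<mu>"
    and "0 < \<delta>" and "\<delta> < 1"
    and "prob_space M"
    and "sampled_from M N X p"
    and "real N \<ge> 1 / \<mu> * ln (2 * (real CARD('s))\<^sup>2 * real CARD('a) / \<delta>)"
  shows "measure M {\<omega> \<in> space M.
           consistent_kernel (empirical_kernel N (\<lambda>s a i. X s a i \<omega>)) p} \<ge> 1 - \<delta>"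
proof -
  interpret prob_space M by fact
  \<comment> \<open>The number of tuples \<open>(s, a, s', d)\<close>, the factor 2 counting the
    values of \<open>d\<close>. Each tuple may fail with probability at most
    \<open>\<delta> / K\<close>.\<close>
  define K where "K = 2 * (real CARD('s))\<^sup>2 * real CARD('a)"
  have "real CARD('s) \<ge> 1" "real CARD('a) \<ge> 1"
    by (simp_all add: Suc_leI)
  then have "1 * 1 \<le> (real CARD('s))\<^sup>2 * real CARD('a)"
    by (intro mult_mono) auto
  then have K: "K \<ge> 2"
    by (simp add: K_def)
  have \<mu>N: "ln (K / \<delta>) \<le> \<mu> * N"
    using assms(2,8) by (simp add: K_def field_simps)
  \<comment> \<open>Since \<open>K / \<delta> > 1\<close>, the sample size bound itself rules out
    \<open>N = 0\<close>.\<close>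
  have "ln (K / \<delta>) > 0"
    using K assms(4,5) by (simp add: field_simps)
  then have N: "N > 0"
    using \<mu>N by (cases N) auto
  have miss: "exp (- (\<mu> * N)) \<le> \<delta> / K"
  proof -
    have "exp (- (\<mu> * N)) \<le> exp (- ln (K / \<delta>))"
      using \<mu>N by simp
    also have "\<dots> = \<delta> / K"
      using K assms(4) by (simp add: exp_minus)
    finally show ?thesis .
  qed
  have ind: "indep_vars (\<lambda>_. count_space UNIV) (X s a) {..<N}" for s a
    using assms(7) by (simp add: sampled_from_def)
  have pr: "prob {\<omega> \<in> space M. X s a i \<omega> = (s', d)} = p s' d s a" if "i < N" for s a i s' d
    using assms(7) that by (simp add: sampled_from_def)
  have ev [measurable]: "{\<omega> \<in> space M. X s a i \<omega> = y} \<in> events" if "i < N" for s a i y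
  proof -
    have "X s a i \<in> measurable M (count_space UNIV)"
      using ind[of s a] that by (simp add: indep_vars_def)
    then show ?thesis by measurable
  qed
  define H where "H s a y = {\<omega> \<in> space M. \<exists>i<N. X s a i \<omega> = y}" for s a y
  have H_Union: "H s a y = (\<Union>i\<in>{..<N}. {\<omega> \<in> space M. X s a i \<omega> = y})" for s a y
    by (auto simp: H_def)
  have H_ev: "H s a y \<in> events" for s a y
    unfolding H_Union using ev by (intro sets.finite_UN) auto
  \<comment> \<open>The bad event of a tuple: an impossible outcome is seen, or a possible one is
    never seen.\<close>
  define B where "B = (\<lambda>(s, a, s', d).
    if p s' d s a = 0 then H s a (s', d) else space M - H s a (s', d))"
  have B_ev: "B t \<in> events" for t
    using H_ev by (auto simp: B_def split: prod.split)
  have B_prob: "prob (B t) \<le> \<delta> / K" for t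
  proof -
    obtain s a s' d where t: "t = (s, a, s', d)"
      by (cases t) auto
    show ?thesis
    proof (cases "p s' d s a = 0")
      case True
      have "prob (H s a (s', d)) \<le> (\<Sum>i\<in>{..<N}. prob {\<omega> \<in> space M. X s a i \<omega> = (s', d)})"
        unfolding H_Union using ev by (intro finite_measure_subadditive_finite) auto
      also have "\<dots> = 0"
        using pr True by simp
      also have "\<dots> \<le> \<delta> / K"
        using assms(4) K by simp
      finally show ?thesis
        using True by (simp add: t B_def)
    next
      case False
      then have q: "p s' d s a \<ge> \<mu>"
        using assms(3) by metis
      \<comment> \<open>Read off from sample 0, which exists as \<open>N > 0\<close>. It makes the
        base \<open>1 - p s' d s a\<close> nonnegative, so that powers are monotone.\<close>
      have "p s' d s a \<le> 1"
        using pr[OF N, of s a s' d] prob_le_1[of "{\<omega> \<in> space M. X s a 0 \<omega> = (s', d)}"] by simp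
      have "space M - H s a (s', d) = {\<omega> \<in> space M. \<forall>i<N. X s a i \<omega> \<noteq> (s', d)}"
        by (auto simp: H_def)
      then have "prob (B t) = (1 - p s' d s a) ^ N"
        using False prob_indep_vars_avoid[OF ind N pr] by (simp add: t B_def)
      \<comment> \<open>The bases compare by
        \<open>1 - p s' d s a \<le> 1 - \<mu> \<le> exp (- \<mu>)\<close>.\<close>
      also have "\<dots> \<le> exp (- \<mu>) ^ N"
        using \<open>p s' d s a \<le> 1\<close> q exp_ge_add_one_self[of "- \<mu>"] by (intro power_mono) auto
      also have "\<dots> = exp (- (\<mu> * N))"
        by (simp add: mult.commute flip: exp_of_nat_mult)
      finally show ?thesis
        using miss by simp
    qed
  qed
  \<comment> \<open>Subadditivity holds for any joint law of the bad events, so samples at different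
    pairs may depend on each other.\<close>
  have "prob (\<Union>t\<in>UNIV. B t) \<le> (\<Sum>t\<in>UNIV. prob (B t))"
    using B_ev by (intro finite_measure_subadditive_finite) auto
  also have "\<dots> \<le> real CARD('s \<times> 'a \<times> 's \<times> bool) * (\<delta> / K)"
    using B_prob by (intro sum_bounded_above)
  also have "real CARD('s \<times> 'a \<times> 's \<times> bool) = K"
    by (simp add: K_def power2_eq_square)
  finally have "prob (\<Union>t\<in>UNIV. B t) \<le> \<delta>"
    using K by simp
  \<comment> \<open>An equality, not merely an inclusion: it also shows that the consistency set is
    an event, being the complement of one.\<close>
  moreover have "{\<omega> \<in> space M. consistent_kernel (empirical_kernel N (\<lambda>s a i. X s a i \<omega>)) p}
      = space M - (\<Union>t\<in>UNIV. B t)"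
    unfolding consistent_empirical_kernel_iff[OF N assms(1)]
    by (auto simp: B_def H_def split: if_splits) metis+
  moreover have "(\<Union>t\<in>UNIV. B t) \<in> events"
    using B_ev by (intro sets.finite_UN) auto
  ultimately show ?thesis
    using prob_compl[of "\<Union>t\<in>UNIV. B t"] by simp
qed

end
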